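(* For every $K_3N$ $n=pqr$: (a) $C\le\mathcal C(H)$; (b) $BC\le\mathcal B(H)\,\mathcal C(H)$; (c) $ABC\le\mathcal A(H)\,\mathcal B(H)\,\mathcal C(H)$; (d) $n\le\mathcal N(H)$; with equality (in each case) if and only if $E=2$ and $F=G=1$. If there is equality then $H\not\equiv 2\pmod 6$, and if also $n$ is a $C_3N$, then $H\equiv 0\pmod 6$.
   Context: A $K_3N$ (Korselt number with three factors) is an integer $n$ together with a factorisation $n=pqr$, where $1<p<q<r$ are odd integers (not necessarily prime) such that each of $p-1,\ q-1,\ r-1$ divides $n-1$, and such that $E:=\dfrac{pq-1}{r-1}$ (which is an integer by the divisibility condition) satisfies $E\ge 2$. A $C_3N$ is a Carmichael number with exactly three prime factors $p<q<r$, i.e. a $K_3N$ $n=pqr$ in which $p,q,r$ are all prime. Put $H:=\gcd(p-1,q-1,r-1)$, $A:=\frac{p-1}{H}$, $B:=\frac{q-1}{H}$, $C:=\frac{r-1}{H}$, $F:=H\left(\frac1A+\frac1B+\frac1C\right)+\frac1{AB}+\frac1{AC}+\frac1{BC}$ (which is a positive integer), and $G:=AF-H$. The following polynomials are used: $\mathcal A(x):=x+1$, $\mathcal B(x):=x^2+x+3$, $\mathcal C(x):=\frac12\left(x^4+2x^3+5x^2+5x+4\right)$, and $$\mathcal N(x):=\tfrac12\left(x^{10}+4x^9+14x^8+30x^7+53x^6+69x^5+71x^4+55x^3+31x^2+12x+2\right).$$ *)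

theory Defs
  imports "HOL-Number_Theory.Number_Theory"
begin

definition Equot :: "int \<Rightarrow> int \<Rightarrow> int \<Rightarrow> rat"
  where "Equot p q r = (of_int p * of_int q - 1) / (of_int r - 1)"

definition K3N :: "int \<Rightarrow> int \<Rightarrow> int \<Rightarrow> int \<Rightarrow> bool"
  where "K3N n p q r \<longleftrightarrow>
    n = p * q * r \<and> 1 < p \<and> p < q \<and> q < r \<and> odd p \<and> odd q \<and> odd r \<and>
    (p - 1) dvd (n - 1) \<and> (q - 1) dvd (n - 1) \<and> (r - 1) dvd (n - 1) \<and>
    Equot p q r \<ge> 2"

definition C3N :: "int \<Rightarrow> int \<Rightarrow> int \<Rightarrow> int \<Rightarrow> bool"
  where "C3N n p q r \<longleftrightarrow> K3N n p q r \<and> prime p \<and> prime q \<and> prime r"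

definition Hgcd :: "int \<Rightarrow> int \<Rightarrow> int \<Rightarrow> int"
  where "Hgcd p q r = gcd (p - 1) (gcd (q - 1) (r - 1))"

(* The three divisions below are exact, because Hgcd divides each numerator. *)

definition Aq :: "int \<Rightarrow> int \<Rightarrow> int \<Rightarrow> int"
  where "Aq p q r = (p - 1) div Hgcd p q r"

definition Bq :: "int \<Rightarrow> int \<Rightarrow> int \<Rightarrow> int"
  where "Bq p q r = (q - 1) div Hgcd p q r"

definition Cq :: "int \<Rightarrow> int \<Rightarrow> int \<Rightarrow> int"
  where "Cq p q r = (r - 1) div Hgcd p q r"

definition Fq :: "int \<Rightarrow> int \<Rightarrow> int \<Rightarrow> rat"
  where "Fq p q r =
    (let H = of_int (Hgcd p q r); A = of_int (Aq p q r);
         B = of_int (Bq p q r); C = of_int (Cq p q r)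
     in H * (1 / A + 1 / B + 1 / C) + 1 / (A * B) + 1 / (A * C) + 1 / (B * C))"

definition Gq :: "int \<Rightarrow> int \<Rightarrow> int \<Rightarrow> rat"
  where "Gq p q r = of_int (Aq p q r) * Fq p q r - of_int (Hgcd p q r)"

definition polyA :: "rat \<Rightarrow> rat"
  where "polyA x = x + 1"

definition polyB :: "rat \<Rightarrow> rat"
  where "polyB x = x^2 + x + 3"

definition polyC :: "rat \<Rightarrow> rat"
  where "polyC x = 1/2 * (x^4 + 2 * x^3 + 5 * x^2 + 5 * x + 4)"

definition polyN :: "rat \<Rightarrow> rat"
  where "polyN x = 1/2 * (x^10 + 4 * x^9 + 14 * x^8 + 30 * x^7 + 53 * x^6 + 69 * x^5
    + 71 * x^4 + 55 * x^3 + 31 * x^2 + 12 * x + 2)"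

end

theory Submission
  imports Defs
begin

text \<open>
  Write \<open>p = HA + 1\<close>, \<open>q = HB + 1\<close>, \<open>r = HC + 1\<close> and \<open>u = HA + 1\<close>. The divisibility conditions force
  \<open>A\<close>, \<open>B\<close>, \<open>C\<close> to be pairwise coprime, so \<open>F\<close> and \<open>G\<close> are integers, and
  \<open>AF = G + H\<close>, \<open>GB = E + u\<close>, \<open>EC = uB + A\<close>. The ordering \<open>A < B < C\<close> gives \<open>2 \<le> E \<le> u\<close> and
  \<open>1 \<le> G < 2H\<close>. For fixed \<open>G\<close>, both \<open>C\<close> and \<open>BC\<close> are largest at \<open>E = 2\<close> and \<open>F = 1\<close>; the
  resulting bounds are Laurent polynomials in \<open>G\<close> with positive coefficients, hence convex,
  and on \<open>[1, 2H]\<close> they are largest at \<open>G = 1\<close>. The bound on \<open>n\<close> follows from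
  \<open>n - 1 = H(H\<^sup>2 + F)ABC \<le> H(H\<^sup>2 + 1)(G + H)BC\<close>.
\<close>

section \<open>Coprimality and integrality of the parameters\<close>

text \<open>A common divisor of \<open>a\<close> and \<open>b\<close> divides every term of the sum
  except \<open>c\<close>, hence also \<open>c\<close>, and so the triple gcd.\<close>

lemma coprime_of_dvd_pair_sum:
  fixes a b c h :: int
  assumes "gcd a (gcd b c) = 1" and "a dvd h * b * c + b + c"
  shows "coprime a b"
proof -
  let ?g = "gcd a b"
  have "?g dvd h * b * c + b + c"
    using assms(2) gcd_dvd1 dvd_trans by blast
  moreover have "?g dvd h * b * c + b"
    by (intro dvd_add) (simp_all add: dvd_mult dvd_mult2)
  ultimately have "?g dvd c"
    using dvd_add_right_iff by blast
  then have "?g dvd gcd a (gcd b c)"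
    by simp
  then show ?thesis
    using assms(1) by (simp add: coprime_iff_gcd_eq_1)
qed

text \<open>Clears denominators, so that the later estimates are purely about integers.\<close>

lemma K3N_parameters:
  assumes "K3N n p q r"
  defines "H \<equiv> Hgcd p q r" and "A \<equiv> Aq p q r" and "B \<equiv> Bq p q r" and "C \<equiv> Cq p q r"
  obtains E F :: int where
    "p = H * A + 1" "q = H * B + 1" "r = H * C + 1"
    "H \<ge> 2" "even H" "0 < A" "A < B" "B < C" "coprime A B"
    "E \<ge> 2" "E * C = H * A * B + A + B"
    "F * (A * B * C) = H * (A * B + A * C + B * C) + A + B + C"
    "Equot p q r = of_int E" "Fq p q r = of_int F"
proof -
  have n: "n = p * q * r" and ord: "1 < p" "p < q" "q < r" and odd: "odd p" "odd q" "odd r"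
    and dvds: "(p - 1) dvd (n - 1)" "(q - 1) dvd (n - 1)" "(r - 1) dvd (n - 1)"
    and E2: "Equot p q r \<ge> 2"
    using assms(1) by (auto simp: K3N_def)
  have Hdvd: "H dvd p - 1" "H dvd q - 1" "H dvd r - 1"
    by (simp_all add: H_def Hgcd_def) (meson dvd_trans gcd_dvd1 gcd_dvd2)+
  have Hpos: "H > 0"
    using ord by (simp add: H_def Hgcd_def)
  have evenH: "even H"
    using odd by (simp add: H_def Hgcd_def)
  then have H2: "H \<ge> 2"
    using Hpos by presburger
  have A: "p - 1 = H * A" and B: "q - 1 = H * B" and C: "r - 1 = H * C"
    using Hdvd by (simp_all add: A_def B_def C_def Aq_def Bq_def Cq_def H_def)
  have pqr: "p = H * A + 1" "q = H * B + 1" "r = H * C + 1"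
    using A B C by simp_all
  have "H * 0 < H * A" "H * A < H * B" "H * B < H * C"
    using ord unfolding pqr by simp_all
  then have A0: "0 < A" and AB: "A < B" and BC: "B < C"
    using Hpos mult_less_cancel_left_pos by blast+
  have "H = gcd (H * A) (gcd (H * B) (H * C))"
    unfolding A[symmetric] B[symmetric] C[symmetric] by (simp add: H_def Hgcd_def)
  also have "\<dots> = H * gcd A (gcd B C)"
    using Hpos by (simp add: gcd_mult_distrib_int[symmetric])
  finally have gcd1: "gcd A (gcd B C) = 1"
    using Hpos by simp
  let ?T = "H\<^sup>2 * A * B * C + H * (A * B + A * C + B * C) + A + B + C"
  have n1: "n - 1 = H * ?T"
    by (simp add: n pqr algebra_simps power2_eq_square)
  let ?S = "H * (A * B + A * C + B * C) + A + B + C"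
  \<comment> \<open>Cancelling \<open>H\<close> in the three hypotheses leaves these. Peeling off
    multiples of \<open>A\<close>, \<open>B\<close>, \<open>C\<close> in turn gives the cyclic pair
    sums to which \<open>coprime_of_dvd_pair_sum\<close> applies.\<close>
  have "A dvd ?T" "B dvd ?T" "C dvd ?T"
    using dvds Hpos unfolding n1 A B C by simp_all
  moreover have "?T = A * (H\<^sup>2 * B * C + H * B + H * C + 1) + (H * B * C + B + C)"
    "?T = B * (H\<^sup>2 * A * C + H * A + H * C + 1) + (H * C * A + C + A)"
    "?T = C * (H\<^sup>2 * A * B + H * A + H * B + 1) + (H * A * B + A + B)"
    by (simp_all add: algebra_simps)
  ultimately have dA: "A dvd H * B * C + B + C" and dB: "B dvd H * C * A + C + A"
    and dC: "C dvd H * A * B + A + B"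
    by (metis dvd_add_right_iff dvd_triv_left)+
  have cAB: "coprime A B"
    using coprime_of_dvd_pair_sum[OF gcd1 dA] .
  have cBC: "coprime B C"
    using coprime_of_dvd_pair_sum[OF _ dB] gcd1 by (simp add: ac_simps)
  have cCA: "coprime C A"
    using coprime_of_dvd_pair_sum[OF _ dC] gcd1 by (simp add: ac_simps)
  \<comment> \<open>\<open>?S\<close> is the numerator of \<open>F\<close> over
    \<open>A * B * C\<close>; it leaves the same pair sums as \<open>?T\<close>.\<close>
  have "?S = A * (H * B + H * C + 1) + (H * B * C + B + C)"
       "?S = B * (H * A + H * C + 1) + (H * C * A + C + A)"
       "?S = C * (H * A + H * B + 1) + (H * A * B + A + B)"
    by (simp_all add: algebra_simps)
  then have "A dvd ?S" "B dvd ?S" "C dvd ?S"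
    using dA dB dC by (metis dvd_add dvd_triv_left)+
  then have "A * B * C dvd ?S"
    using cAB cBC cCA by (intro divides_mult) (simp_all add: coprime_commute)
  then obtain F where F: "F * (A * B * C) = ?S"
    by (metis dvdE mult.commute)
  obtain E where E: "E * C = H * A * B + A + B"
    using dC by (metis dvdE mult.commute)
  have "of_int (r - 1) \<noteq> (0 :: rat)"
    using ord by simp
  moreover have "p * q - 1 = E * (r - 1)"
  proof -
    have "E * (r - 1) = H * (E * C)"
      by (simp add: pqr)
    then show ?thesis
      unfolding E by (simp add: pqr algebra_simps)
  qed
  then have "of_int p * of_int q - 1 = (of_int E * of_int (r - 1) :: rat)"
    by (metis of_int_1 of_int_diff of_int_mult)
  ultimately have Eq: "Equot p q r = of_int E"
    by (simp add: Equot_def)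
  have "(of_int ?S :: rat) = of_int F * (of_int A * of_int B * of_int C)"
    by (metis F of_int_mult)
  moreover have "(of_int A :: rat) \<noteq> 0" "(of_int B :: rat) \<noteq> 0" "(of_int C :: rat) \<noteq> 0"
    using A0 AB BC by simp_all
  ultimately have "Fq p q r = of_int F"
    unfolding Fq_def Let_def A_def[symmetric] B_def[symmetric] C_def[symmetric] H_def[symmetric]
    by (simp add: field_simps)
  moreover have "E \<ge> 2"
    using E2 unfolding Eq by simp
  ultimately show ?thesis
    using that pqr H2 evenH A0 AB BC cAB E F Eq by blast
qed

section \<open>Slack factorisations and parameter ranges\<close>

text \<open>Yields each bound together with its equality case: the factor \<open>t\<close> will be
  \<open>E - 2\<close>, \<open>G + H - A\<close> or \<open>G - 1\<close>, so a vanishing gap fixes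
  that parameter.\<close>

lemma le_of_scaled_slack:
  fixes k t x y z :: int
  assumes "k * (x - y) = t * z" and "0 < k" "0 \<le> t" "0 < z"
  shows "y \<le> x" and "y = x \<Longrightarrow> t = 0"
proof -
  have "0 \<le> k * (x - y)"
    unfolding assms(1) using assms by simp
  then show "y \<le> x"
    using assms(2) by (simp add: zero_le_mult_iff)
  show "t = 0" if "y = x"
    using assms that by simp
qed

lemma squeeze4:
  fixes a b c d :: "'a :: order"
  assumes "a \<le> b" "b \<le> c" "c \<le> d"
  shows "a \<le> d" and "a = d \<Longrightarrow> a = b \<and> b = c \<and> c = d"
  using assms by auto

text \<open>\<open>C \<ge> B + 1\<close> makes \<open>E * C\<close> too large if
  \<open>E \<ge> H * A + 2\<close>; then \<open>B \<ge> A + 1\<close> makes \<open>G * B\<close> too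
  large if \<open>G \<ge> 2 * H\<close>.\<close>

lemma parameter_ranges:
  fixes H A B C E G :: int
  assumes "H \<ge> 2" "0 < A" "A < B" "B < C" "E \<ge> 2"
    and EC: "E * C = H * A * B + A + B" and GB: "G * B = E + H * A + 1"
  shows "E \<le> H * A + 1" "1 \<le> G" "G < 2 * H"
proof -
  have HA: "H * A > 0"
    using assms by simp
  show E: "E \<le> H * A + 1"
  proof (rule ccontr)
    assume "\<not> E \<le> H * A + 1"
    then have "(H * A + 2) * (B + 1) \<le> E * C"
      using assms HA by (intro mult_mono) linarith+
    moreover have "(H * A + 2) * (B + 1) = H * A * B + H * A + 2 * B + 2"
      by (simp add: algebra_simps)
    ultimately show False
      using assms(3) EC HA \<open>0 < A\<close> by linarith
  qed
  have "0 < G * B"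
    using GB HA assms(5) by linarith
  moreover have "0 < B"
    using assms(2,3) by linarith
  ultimately have "0 < G"
    by (rule zero_less_mult_pos2)
  then show "1 \<le> G"
    by simp
  show "G < 2 * H"
  proof (rule ccontr)
    assume "\<not> G < 2 * H"
    then have "(2 * H) * (A + 1) \<le> G * B"
      using assms by (intro mult_mono) auto
    then show False
      using E assms unfolding GB by (simp add: algebra_simps)
  qed
qed

section \<open>The extremal bounds for C and BC\<close>

lemma C_bound:
  fixes H A B C E G :: int
  assumes H: "H \<ge> 2" and A: "0 < A" "A \<le> G + H" and E: "E \<ge> 2"
    and G: "1 \<le> G" "G < 2 * H"
    and EC: "E * C = H * A * B + A + B" and GB: "G * B = E + H * A + 1"
  defines "s \<equiv> H^4 + 2 * H^3 + 5 * H^2 + 5 * H + 4"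
  shows "2 * C \<le> s" and "2 * C = s \<Longrightarrow> E = 2 \<and> G = 1 \<and> A = G + H"
proof -
  \<comment> \<open>\<open>?X a\<close> is the value of \<open>2 * G * C\<close> at
    \<open>E = 2\<close> and \<open>A = a\<close>.\<close>
  let ?X = "\<lambda>a. (H * a + 1) * (H * a + 3) + G * a"
  have "E * (?X A - 2 * G * C) = E * ?X A - 2 * G * (E * C)"
    by (simp add: algebra_simps)
  also have "\<dots> = E * ?X A - 2 * ((H * A + 1) * (G * B) + G * A)"
    unfolding EC by (simp add: algebra_simps)
  also have "\<dots> = (E - 2) * ((H * A + 1)\<^sup>2 + G * A)"
    unfolding GB by (simp add: algebra_simps power2_eq_square)
  finally have slack: "E * (?X A - 2 * G * C) = (E - 2) * ((H * A + 1)\<^sup>2 + G * A)" .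
  have pos: "(H * A + 1)\<^sup>2 + G * A > 0"
    using A G by (intro add_nonneg_pos) auto
  have 1: "2 * G * C \<le> ?X A" "2 * G * C = ?X A \<Longrightarrow> E = 2"
    using le_of_scaled_slack[OF slack _ _ pos] E by simp_all
  have slack2: "1 * (?X (G + H) - ?X A) = (G + H - A) * (H * (H * A + 1) + H * (H * (G + H) + 3) + G)"
    by (simp add: algebra_simps)
  have pos2: "H * (H * A + 1) + H * (H * (G + H) + 3) + G > 0"
    using H A G by (simp add: add_pos_pos)
  have 2: "?X A \<le> ?X (G + H)" "?X A = ?X (G + H) \<Longrightarrow> A = G + H"
    using le_of_scaled_slack[OF slack2 _ _ pos2] A by simp_all
  \<comment> \<open>\<open>s\<close> is \<open>?X (G + H)\<close> at \<open>G = 1\<close>.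
    Positivity of the last factor comes from \<open>G < 2 * H \<le> H^2 + 1\<close>.\<close>
  have slack3: "1 * (G * s - ?X (G + H)) = (G - 1) * ((H\<^sup>2 + 1) * (H\<^sup>2 + 3 - G))"
    by (simp add: s_def algebra_simps power2_eq_square power3_eq_cube power4_eq_xxxx)
  have "H\<^sup>2 + 3 - G > 0"
    using G zero_le_power2[of "H - 1"] by (simp add: power2_diff)
  then have pos3: "(H\<^sup>2 + 1) * (H\<^sup>2 + 3 - G) > 0"
    by (simp add: add_nonneg_pos)
  have 3: "?X (G + H) \<le> G * s" "?X (G + H) = G * s \<Longrightarrow> G = 1"
    using le_of_scaled_slack[OF slack3 _ _ pos3] G by simp_all
  note chain = squeeze4[OF 1(1) 2(1) 3(1)]
  have assoc: "2 * G * C = G * (2 * C)"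
    by simp
  show "2 * C \<le> s"
    using chain(1) G unfolding assoc by simp
  assume "2 * C = s"
  then have "2 * G * C = G * s"
    unfolding assoc by simp
  then show "E = 2 \<and> G = 1 \<and> A = G + H"
    using chain(2) 1(2) 2(2) 3(2) by blast
qed

text \<open>The weight \<open>G + H\<close> is at least both \<open>H + 1\<close> and
  \<open>A\<close>, so this one bound serves \<open>BC\<close>, \<open>ABC\<close> and
  \<open>n\<close>.\<close>

lemma GBC_bound:
  fixes H A B C E G :: int
  assumes H: "H \<ge> 2" and A: "0 < A" "A \<le> G + H" and E: "E \<ge> 2" "E \<le> H * A + 1"
    and G: "1 \<le> G" "G < 2 * H"
    and EC: "E * C = H * A * B + A + B" and GB: "G * B = E + H * A + 1"
  defines "s \<equiv> (H + 1) * (H\<^sup>2 + H + 3) * (H^4 + 2 * H^3 + 5 * H^2 + 5 * H + 4)"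
  shows "2 * ((G + H) * (B * C)) \<le> s"
    and "2 * ((G + H) * (B * C)) = s \<Longrightarrow> E = 2 \<and> G = 1 \<and> A = G + H"
proof -
  define u where "u = H * A + 1"
  define c where "c = H\<^sup>2 + 1"
  \<comment> \<open>The value of \<open>2 * G^2 * B * C\<close> at \<open>E = 2\<close> and
    \<open>A = a\<close>.\<close>
  let ?X = "\<lambda>a. (H * a + 3) * ((H * a + 1) * (H * a + 3) + G * a)"
  have "H * A \<ge> 2 * 1"
    using H A by (intro mult_mono) auto
  then have u3: "u \<ge> 3"
    by (simp add: u_def)
  have "E * (?X A - 2 * G\<^sup>2 * (B * C)) = E * ?X A - 2 * (G * B) * (G * (E * C))"
    by (simp add: algebra_simps power2_eq_square)
  also have "\<dots> = E * ?X A - 2 * (G * B) * (u * (G * B) + G * A)"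
    unfolding EC by (simp add: algebra_simps u_def)
  also have "\<dots> = (E - 2) * (u * (u\<^sup>2 - 2 * E) + G * A * u)"
    unfolding GB by (simp add: algebra_simps power2_eq_square u_def)
  finally have slack:
    "E * (?X A - 2 * G\<^sup>2 * (B * C)) = (E - 2) * (u * (u\<^sup>2 - 2 * E) + G * A * u)" .
  \<comment> \<open>The upper bound on \<open>E\<close> enters here:
    \<open>2 * E \<le> 2 * u < 3 * u \<le> u^2\<close>.\<close>
  have "u * 3 \<le> u * u"
    using u3 by (intro mult_left_mono) auto
  then have "u\<^sup>2 - 2 * E > 0"
    using u3 E(2)[folded u_def] unfolding power2_eq_square by linarith
  then have pos: "u * (u\<^sup>2 - 2 * E) + G * A * u > 0"
    using A G u3 by (intro add_pos_pos mult_pos_pos) auto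
  have 1: "2 * G\<^sup>2 * (B * C) \<le> ?X A" "2 * G\<^sup>2 * (B * C) = ?X A \<Longrightarrow> E = 2"
    using le_of_scaled_slack[OF slack _ _ pos] E by simp_all
  have 2: "?X A \<le> ?X (G + H)" "?X A = ?X (G + H) \<Longrightarrow> A = G + H"
  proof -
    have m: "H * A \<le> H * (G + H)" "G * A \<le> G * (G + H)"
      using H A G by (auto intro!: mult_left_mono)
    have m0: "0 \<le> H * A" "0 \<le> G * A"
      using H A G by auto
    have Q: "(H * A + 1) * (H * A + 3) \<le> (H * (G + H) + 1) * (H * (G + H) + 3)"
      using m m0 by (intro mult_mono) linarith+
    have Q0: "0 < (H * A + 1) * (H * A + 3)"
      using m0 by (intro mult_pos_pos) linarith+
    have le: "?X A \<le> ?X (G + H)"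
      using m m0 Q Q0 by (intro mult_mono) linarith+
    have less: "?X A < ?X (G + H)" if "A < G + H"
    proof -
      have "H * A < H * (G + H)"
        using that H by (intro mult_strict_left_mono) linarith+
      then show ?thesis
        using m m0 Q Q0 by (intro mult_less_le_imp_less) linarith+
    qed
    show "?X A \<le> ?X (G + H)"
      by (fact le)
    show "A = G + H" if "?X A = ?X (G + H)"
      using that less A by linarith
  qed
  \<comment> \<open>In \<open>(G + H) X(G + H) / G\<^sup>2\<close>, these are the coefficients of \<open>G\<^sup>2\<close> (\<open>a2\<close>), \<open>G\<close> (\<open>a1\<close>),
    \<open>1/G\<close> (\<open>b1\<close>) and \<open>1/G\<^sup>2\<close> (\<open>b2\<close>). The constant term cancels from the difference of the
    values at \<open>1\<close> and \<open>G\<close>.\<close>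
  define a2 where "a2 = H * c"
  define a1 where "a1 = H\<^sup>2 * (4 * c + 5) + c + 2"
  define b1 where "b1 = c * (c + 2)\<^sup>2 + 3 * H\<^sup>2 * (c + 2) * (c + 1)"
  define b2 where "b2 = H * c * (c + 2)\<^sup>2"
  have c0: "c > 0"
    by (simp add: c_def add_nonneg_pos)
  have c2: "2 * H \<le> c"
    using zero_le_power2[of "H - 1"] by (simp add: c_def power2_diff)
  \<comment> \<open>The coefficients of \<open>1/G\<close> and \<open>1/G^2\<close> dominate those
    of \<open>G\<close> and \<open>G^2\<close> because \<open>G < 2 * H \<le> c\<close>.\<close>
  have "G * a1 \<le> 2 * H * a1"
    using G c0 by (intro mult_right_mono) (auto simp: a1_def)
  also have "\<dots> \<le> c * a1"
    using c2 c0 by (intro mult_right_mono) (auto simp: a1_def)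
  also have "\<dots> < b1"
  proof -
    have "b1 - c * a1 = 8 * c\<^sup>2 + 4 * c - 6"
      unfolding a1_def b1_def c_def by (simp add: algebra_simps eval_nat_numeral)
    moreover have "c \<ge> 4"
      using c2 H by simp
    ultimately show ?thesis
      by (smt (verit) zero_le_power2)
  qed
  finally have p1: "b1 - G * a1 > 0"
    by simp
  have "G\<^sup>2 \<le> (c + 2)\<^sup>2"
    using G c2 by (intro power_mono) auto
  then have "G\<^sup>2 * a2 \<le> (c + 2)\<^sup>2 * a2"
    using H c0 by (intro mult_right_mono) (auto simp: a2_def)
  then have p2: "b2 - G\<^sup>2 * a2 \<ge> 0"
    by (simp add: a2_def b2_def algebra_simps)
  \<comment> \<open>\<open>s\<close> is the value at \<open>G = 1\<close>; pairing each power of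
    \<open>G\<close> with its inverse extracts \<open>G - 1\<close>.\<close>
  have slack3: "1 * (G\<^sup>2 * s - (G + H) * ?X (G + H))
      = (G - 1) * (G * (b1 - G * a1) + (G + 1) * (b2 - G\<^sup>2 * a2))"
    unfolding s_def a1_def a2_def b1_def b2_def c_def by (simp add: algebra_simps eval_nat_numeral)
  have pos3: "G * (b1 - G * a1) + (G + 1) * (b2 - G\<^sup>2 * a2) > 0"
    using p1 p2 G by (intro add_pos_nonneg) auto
  have 3: "(G + H) * ?X (G + H) \<le> G\<^sup>2 * s" "(G + H) * ?X (G + H) = G\<^sup>2 * s \<Longrightarrow> G = 1"
    using le_of_scaled_slack[OF slack3 _ _ pos3] G by simp_all
  have GH: "G + H > 0"
    using G H by simp
  have 4: "(G + H) * (2 * G\<^sup>2 * (B * C)) \<le> (G + H) * ?X A" "(G + H) * ?X A \<le> (G + H) * ?X (G + H)"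
    using 1(1) 2(1) GH by (simp_all only: mult_le_cancel_left_pos)
  note chain = squeeze4[OF 4 3(1)]
  have assoc: "(G + H) * (2 * G\<^sup>2 * (B * C)) = G\<^sup>2 * (2 * ((G + H) * (B * C)))"
    by (simp add: ac_simps)
  show "2 * ((G + H) * (B * C)) \<le> s"
    using chain(1) G unfolding assoc by simp
  assume "2 * ((G + H) * (B * C)) = s"
  then have "(G + H) * (2 * G\<^sup>2 * (B * C)) = G\<^sup>2 * s"
    unfolding assoc by simp
  note eqs = chain(2)[OF this]
  have cancel: "x = y" if "(G + H) * x = (G + H) * y" for x y
    using that GH by simp
  show "E = 2 \<and> G = 1 \<and> A = G + H"
    using eqs 1(2) 2(2) 3(2) cancel by blast
qed

section \<open>The four bounds and their equality cases\<close>

theorem theorem4p9: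
  fixes n p q r :: int
  assumes "K3N n p q r"
  shows "let H = Hgcd p q r; A = Aq p q r; B = Bq p q r; C = Cq p q r;
             h = (of_int H :: rat);
             extremal = (Equot p q r = 2 \<and> Fq p q r = 1 \<and> Gq p q r = 1);
             eq_a = (of_int C = polyC h);
             eq_b = (of_int (B * C) = polyB h * polyC h);
             eq_c = (of_int (A * B * C) = polyA h * polyB h * polyC h);
             eq_d = (of_int n = polyN h)
         in of_int C \<le> polyC h \<and> (eq_a \<longleftrightarrow> extremal) \<and>
            of_int (B * C) \<le> polyB h * polyC h \<and> (eq_b \<longleftrightarrow> extremal) \<and>
            of_int (A * B * C) \<le> polyA h * polyB h * polyC h \<and> (eq_c \<longleftrightarrow> extremal) \<and>
            of_int n \<le> polyN h \<and> (eq_d \<longleftrightarrow> extremal) \<and>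
            (eq_a \<or> eq_b \<or> eq_c \<or> eq_d \<longrightarrow>
               \<not> [H = 2] (mod 6) \<and> (C3N n p q r \<longrightarrow> [H = 0] (mod 6)))"
proof -
  define H where "H = Hgcd p q r"
  define A where "A = Aq p q r"
  define B where "B = Bq p q r"
  define C where "C = Cq p q r"
  obtain E F :: int where
    pqr: "p = H * A + 1" "q = H * B + 1" "r = H * C + 1" and
    H: "H \<ge> 2" "even H" and ord: "0 < A" "A < B" "B < C" and cop: "coprime A B" and
    E: "E \<ge> 2" "E * C = H * A * B + A + B" and
    F: "F * (A * B * C) = H * (A * B + A * C + B * C) + A + B + C" and
    Eq: "Equot p q r = of_int E" and Fq: "Fq p q r = of_int F"
    using K3N_parameters[OF assms] unfolding H_def A_def B_def C_def by blast
  define G where "G = A * F - H"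
  have Gq: "Gq p q r = of_int G"
    by (simp add: Gq_def Fq G_def A_def H_def)
  \<comment> \<open>Subtracting the equation for \<open>E * C\<close> from that for \<open>F\<close>
    leaves a multiple of \<open>C\<close>.\<close>
  have "C * (F * A * B - H * (A + B) - 1) = C * E"
    using E(2) F by (simp add: algebra_simps)
  then have "F * A * B - H * (A + B) - 1 = E"
    using ord by (subst (asm) mult_left_cancel) linarith+
  then have GB: "G * B = E + H * A + 1"
    by (simp add: G_def algebra_simps)
  have "0 < F * (A * B * C)"
    unfolding F using ord H by (intro add_pos_pos mult_pos_pos) linarith+
  moreover have "0 < A * B * C"
    using ord by (intro mult_pos_pos) linarith+
  ultimately have "0 < F"
    by (rule zero_less_mult_pos2)
  then have F0: "F \<ge> 1"
    by simp
  have AF: "A * F = G + H"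
    by (simp add: G_def)
  have AG: "A \<le> G + H"
    unfolding AF[symmetric] using F0 ord by simp
  note ranges = parameter_ranges[OF H(1) ord E GB]

  define t where "t = H\<^sup>2 + H + 3"
  define s where "s = H^4 + 2 * H^3 + 5 * H^2 + 5 * H + 4"
  define ext where "ext \<longleftrightarrow> E = 2 \<and> F = 1 \<and> G = 1"
  have ext_iff: "Equot p q r = 2 \<and> Fq p q r = 1 \<and> Gq p q r = 1 \<longleftrightarrow> ext"
    by (simp add: Eq Fq Gq ext_def)
  have extI: "ext" if "E = 2 \<and> G = 1 \<and> A = G + H"
    using that AF H by (simp add: ext_def)
  have extremal_values: "A = H + 1" "B = t" "2 * C = s" if ext
  proof -
    show A: "A = H + 1"
      using that AF by (simp add: ext_def)
    show B: "B = t"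
      using that GB by (simp add: ext_def A t_def power2_eq_square algebra_simps)
    have "2 * C = H * A * B + A + B"
      using that E by (simp add: ext_def)
    then show "2 * C = s"
      unfolding A B t_def s_def by (simp add: algebra_simps eval_nat_numeral)
  qed
  have BC0: "B * C > 0"
    using ord by simp
  define w where "w = (G + H) * (2 * (B * C))"
  have w: "w \<le> (H + 1) * t * s" "w = (H + 1) * t * s \<Longrightarrow> ext"
    using GBC_bound[OF H(1) ord(1) AG E(1) ranges E(2) GB, folded s_def t_def] extI
    by (simp_all add: w_def mult.left_commute)

  have a: "2 * C \<le> s" "2 * C = s \<longleftrightarrow> ext"
    using C_bound[OF H(1) ord(1) AG E(1) ranges(2,3) E(2) GB, folded s_def] extI extremal_values(3)
    by blast+
  have "(H + 1) * (2 * (B * C)) \<le> w"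
    unfolding w_def using ranges BC0 by (intro mult_right_mono) auto
  then have b1: "(H + 1) * (2 * (B * C)) \<le> (H + 1) * (t * s)"
    "2 * (B * C) = t * s \<Longrightarrow> w = (H + 1) * t * s"
    using w(1) by (simp_all add: mult.assoc)
  have b: "2 * (B * C) \<le> t * s" "2 * (B * C) = t * s \<longleftrightarrow> ext"
    using b1 w(2) extremal_values H by auto
  have "A * (2 * (B * C)) \<le> w"
    unfolding w_def using AG BC0 by (intro mult_right_mono) auto
  then have c1: "2 * (A * B * C) \<le> w"
    by (simp add: ac_simps)
  have "2 * (A * B * C) = A * B * (2 * C)"
    by simp
  then have "2 * (A * B * C) = (H + 1) * t * s" if ext
    unfolding extremal_values[OF that] .
  then have c: "2 * (A * B * C) \<le> (H + 1) * t * s" "2 * (A * B * C) = (H + 1) * t * s \<longleftrightarrow> ext"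
    using w c1 by (blast intro: order_trans antisym, metis antisym)
  have n: "n = p * q * r"
    using assms by (simp add: K3N_def)
  have "n - 1 = H * (H\<^sup>2 * (A * B * C) + (H * (A * B + A * C + B * C) + A + B + C))"
    by (simp add: n pqr algebra_simps power2_eq_square)
  \<comment> \<open>Since \<open>A * F = G + H\<close>, replacing \<open>A\<close> by
    \<open>G + H\<close> in the first summand gives a multiple of \<open>w\<close>.\<close>
  also have "\<dots> = H * (H\<^sup>2 * A + A * F) * (B * C)"
    unfolding F[symmetric] by (simp add: algebra_simps)
  finally have n1: "2 * (n - 1) = H * ((H\<^sup>2 * A + (G + H)) * (2 * (B * C)))"
    unfolding AF by simp
  have "(H\<^sup>2 * A + (G + H)) * (2 * (B * C)) \<le> (H\<^sup>2 * (G + H) + (G + H)) * (2 * (B * C))"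
    using AG BC0 by (intro mult_right_mono add_mono mult_left_mono) auto
  also have "\<dots> = (H\<^sup>2 + 1) * w"
    by (simp add: w_def algebra_simps)
  finally have "2 * (n - 1) \<le> H * ((H\<^sup>2 + 1) * w)"
    unfolding n1 using H by (intro mult_left_mono) auto
  moreover define K where "K = H * (H\<^sup>2 + 1)"
  ultimately have n2: "2 * (n - 1) \<le> K * w"
    by (simp add: mult.assoc)
  have K: "K > 0"
    using H by (simp add: K_def add_nonneg_pos)
  define M where "M = (H + 1) * t * s"
  have KM: "K * w \<le> K * M"
    using w(1) K by (simp add: M_def)
  have "2 * n \<le> 2 + y \<and> (2 * n = 2 + y \<longrightarrow> x = y)" if "x \<le> y" "2 * (n - 1) \<le> x" for x y
    using that by auto
  from this[OF KM n2] have d1: "2 * n \<le> 2 + K * M" "2 * n = 2 + K * M \<Longrightarrow> K * w = K * M"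
    by blast+
  have d2: "2 * n = 2 + K * M" if ext
  proof -
    have "2 * (n - 1) = H * ((H\<^sup>2 * A + A) * (B * (2 * C)))"
      unfolding n1 AF[symmetric] using that by (simp add: ext_def)
    then show ?thesis
      unfolding extremal_values[OF that] K_def M_def by (simp add: algebra_simps power2_eq_square)
  qed
  have d: "2 * n \<le> 2 + K * M" "2 * n = 2 + K * M \<longleftrightarrow> ext"
    using d1 d2 w(2) K by (auto simp: M_def)

  \<comment> \<open>Residues of H in the equality case\<close>
  have not2: "\<not> [H = 2] (mod 6)" if ext
  proof
    assume "[H = 2] (mod 6)"
    then obtain k where k: "H = 2 + 6 * k"
      by (metis cong_iff_lin cong_sym)
    \<comment> \<open>The extremal values \<open>H + 1\<close> and \<open>H^2 + H + 3\<close> share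
      the factor 3.\<close>
    have "A = 3 * (1 + 2 * k)" "B = 3 * (3 + 10 * k + 12 * k\<^sup>2)"
      using extremal_values[OF that] by (simp_all add: k t_def power2_eq_square algebra_simps)
    then have "3 dvd A" "3 dvd B"
      by simp_all
    then show False
      using cop not_coprimeI[of 3 A B] by simp
  qed
  have zero: "[H = 0] (mod 6)" if ext "C3N n p q r"
  proof -
    \<comment> \<open>As \<open>H\<close> is even, only residue 4 remains; there 3 divides
      \<open>p = H^2 + H + 1\<close>, yet \<open>p \<ge> 5\<close>.\<close>
    have "\<not> [H = 4] (mod 6)"
    proof
      assume "[H = 4] (mod 6)"
      then obtain k where k: "H = 4 + 6 * k"
        by (metis cong_iff_lin cong_sym)
      have "p = 3 * (7 + 18 * k + 12 * k\<^sup>2)"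
        using extremal_values[OF that(1)] by (simp add: k pqr power2_eq_square algebra_simps)
      then have "3 dvd p"
        by simp
      moreover have "prime p"
        using that(2) by (simp add: C3N_def)
      ultimately have "p = 3"
        by (auto simp: prime_int_iff dest: spec[of _ 3])
      moreover have "2 * 2 \<le> H * A"
        using H extremal_values(1)[OF that(1)] by (intro mult_mono) auto
      ultimately show False
        by (simp add: pqr)
    qed
    moreover have "H mod 6 \<in> {0..5}"
      by simp
    then have "H mod 6 \<in> {0, 1, 2, 3, 4, 5}"
      by (simp add: simp_from_to)
    moreover have "even (H mod 6)"
      using H(2) by (simp add: dvd_mod_iff)
    ultimately show ?thesis
      using not2[OF that(1)] by (auto simp: cong_def)
  qed

  have half: "of_int x \<le> of_int y / (2 :: rat) \<longleftrightarrow> 2 * x \<le> y"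
    "of_int x = of_int y / (2 :: rat) \<longleftrightarrow> 2 * x = y" for x y :: int
    by linarith+
  \<comment> \<open>The last identity says that \<open>polyN x\<close> is
    \<open>1 + x * (x^2 + 1) * polyA x * polyB x * polyC x\<close> at \<open>x = H\<close>.\<close>
  have polys: "polyA (of_int H) * polyB (of_int H) * polyC (of_int H) = of_int ((H + 1) * t * s) / 2"
    "polyB (of_int H) * polyC (of_int H) = of_int (t * s) / 2"
    "polyC (of_int H) = of_int s / 2"
    "polyN (of_int H) = of_int (2 + K * M) / 2"
    by (simp_all add: polyA_def polyB_def polyC_def polyN_def s_def t_def K_def M_def
        field_simps eval_nat_numeral)
  show ?thesis
    unfolding Let_def ext_iff H_def[symmetric] A_def[symmetric] B_def[symmetric] C_def[symmetric]
    unfolding polys(1) unfolding polys(2) unfolding polys(3,4) half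
    using a b c d not2 zero by blast
qed

end
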